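(* Let $0\le a\in\mathcal{A}$ with $\|a\|\le L$, and let $0<t\le1$. Let $\sigma(a)\ge 0$ be given by $\sigma(a)^2=\tau(a^2)-\tau(a)^2$. Then $$\|a\|_{(t)}\ \ge\ \tau(a)+\big(1+\epsilon(a,1/t)\big)\,\sigma(a)\sqrt{t(1-t)}-t\,(L+\tau(a)),$$ where, for $s\ge1$, $$\epsilon(a,s)=\frac{\sigma(a)\sqrt{s-1}}{L+\sigma(a)\sqrt{s-1}}$$ (with $\epsilon(a,s):=0$ if the denominator vanishes).
   Context: $\mathcal{A}$ is a $II_1$ factor with faithful normal tracial state $\tau$ ($\tau(1)=1$), $\|\cdot\|$ is the operator norm. For $t\in(0,1]$, $p_t\in\mathcal{A}$ is a projection with $\tau(p_t)=t$ that is free (in Voiculescu's sense, with respect to $\tau$) from $a$. The $(t)$-norm of $a$ is $\|a\|_{(t)}:=\|p_tap_t\|$ (operator norm). *)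

theory Defs
  imports "HOL-Analysis.Analysis"
begin

section \<open>Complex Hilbert spaces and their bounded operators\<close>

text \<open>
  The inner product is linear in the first argument. Definiteness of the inner product and
  completeness come from the superclass \<^class>\<open>banach\<close> together with the axiom \<open>norm_cinner\<close>.
\<close>

class complex_hilbert = banach +
  fixes scaleC :: "complex \<Rightarrow> 'a \<Rightarrow> 'a"  (infixr \<open>*\<^sub>C\<close> 75)
    and cinner :: "'a \<Rightarrow> 'a \<Rightarrow> complex"
  assumes scaleR_scaleC: "r *\<^sub>R x = complex_of_real r *\<^sub>C x"
    and scaleC_add_right: "c *\<^sub>C (x + y) = c *\<^sub>C x + c *\<^sub>C y"
    and scaleC_add_left: "(c + d) *\<^sub>C x = c *\<^sub>C x + d *\<^sub>C x"
    and scaleC_scaleC: "c *\<^sub>C (d *\<^sub>C x) = (c * d) *\<^sub>C x"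
    and scaleC_one: "1 *\<^sub>C x = x"
    and cinner_commute: "cinner x y = cnj (cinner y x)"
    and cinner_add_left: "cinner (x + y) z = cinner x z + cinner y z"
    and cinner_scaleC_left: "cinner (c *\<^sub>C x) y = c * cinner x y"
    and norm_cinner: "complex_of_real ((norm x)\<^sup>2) = cinner x x"

instantiation complex :: complex_hilbert
begin

definition scaleC_complex :: "complex \<Rightarrow> complex \<Rightarrow> complex"
  where "scaleC_complex c x = c * x"

definition cinner_complex :: "complex \<Rightarrow> complex \<Rightarrow> complex"
  where "cinner_complex x y = x * cnj y"

instance
proof
  fix x :: complex
  show "complex_of_real ((norm x)\<^sup>2) = cinner x x"
    unfolding cinner_complex_def by (rule complex_norm_square)
qed (simp_all add: scaleC_complex_def cinner_complex_def scaleR_conv_of_real algebra_simps)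

end

lemma norm_scaleC: "norm (c *\<^sub>C x) = cmod c * norm (x :: 'a :: complex_hilbert)"
proof -
  have right: "cinner x (c *\<^sub>C x) = cnj c * cinner x x"
    by (metis cinner_commute cinner_scaleC_left complex_cnj_mult)
  have "complex_of_real ((norm (c *\<^sub>C x))\<^sup>2) = (c * cnj c) * cinner x x"
    unfolding norm_cinner by (simp add: cinner_scaleC_left right)
  also have "\<dots> = complex_of_real ((cmod c * norm x)\<^sup>2)"
    unfolding complex_norm_square[symmetric] norm_cinner[symmetric]
    by (simp add: power_mult_distrib)
  finally have "(norm (c *\<^sub>C x))\<^sup>2 = (cmod c * norm x)\<^sup>2"
    by (simp only: of_real_eq_iff)
  then show ?thesis
    by (simp add: power2_eq_iff_nonneg)
qed

lemma bounded_linear_scaleC: "bounded_linear (\<lambda>x :: 'a :: complex_hilbert. c *\<^sub>C x)"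
proof (rule bounded_linear_intro)
  show "c *\<^sub>C (r *\<^sub>R x) = r *\<^sub>R (c *\<^sub>C x)" for r and x :: 'a
    by (simp add: scaleR_scaleC scaleC_scaleC mult.commute)
  show "norm (c *\<^sub>C x) \<le> norm x * cmod c" for x :: 'a
    by (simp add: norm_scaleC mult.commute)
qed (rule scaleC_add_right)

text \<open>
  Operators have the library type \<open>'h \<Rightarrow>\<^sub>L 'h\<close> of bounded real-linear maps, whose \<^const>\<open>norm\<close> is
  the operator norm; \<open>bounded_ops\<close> is the subset of complex-linear ones, i.e. B(H).
\<close>

type_synonym 'h op = "'h \<Rightarrow>\<^sub>L 'h"

definition bounded_ops :: "'h::complex_hilbert op set"
  where "bounded_ops = {T. \<forall>c x. blinfun_apply T (c *\<^sub>C x) = c *\<^sub>C blinfun_apply T x}"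

definition scaleC_op :: "complex \<Rightarrow> 'h::complex_hilbert op \<Rightarrow> 'h op"
  where "scaleC_op c T = Blinfun (\<lambda>x. c *\<^sub>C blinfun_apply T x)"

lemma scaleC_op_apply [simp]: "blinfun_apply (scaleC_op c T) x = c *\<^sub>C blinfun_apply T x"
  unfolding scaleC_op_def
  by (subst bounded_linear_Blinfun_apply)
     (auto intro: bounded_linear_compose[OF bounded_linear_scaleC] blinfun.bounded_linear_right)

text \<open>\<open>is_adjoint T S\<close> says \<open>S = T\<^sup>*\<close>; the adjoint is unique and, on all of B(H), exists.\<close>

definition is_adjoint :: "'h::complex_hilbert op \<Rightarrow> 'h op \<Rightarrow> bool"
  where "is_adjoint T S \<longleftrightarrow>
    (\<forall>x y. cinner (blinfun_apply T x) y = cinner x (blinfun_apply S y))"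

definition positive_op :: "'h::complex_hilbert op \<Rightarrow> bool"
  where "positive_op T \<longleftrightarrow> (\<forall>x. cinner (blinfun_apply T x) x \<in> \<real>\<^sub>\<ge>\<^sub>0)"

definition op_le :: "'h::complex_hilbert op \<Rightarrow> 'h op \<Rightarrow> bool"
  where "op_le S T \<longleftrightarrow> positive_op (T - S)"

definition projection_op :: "'h::complex_hilbert op \<Rightarrow> bool"
  where "projection_op p \<longleftrightarrow> is_adjoint p p \<and> p o\<^sub>L p = p"

section \<open>Von Neumann algebras and \<open>II\<^sub>1\<close> factors\<close>

definition commutant :: "'h::complex_hilbert op set \<Rightarrow> 'h op set"
  where "commutant S = {T \<in> bounded_ops. \<forall>s\<in>S. T o\<^sub>L s = s o\<^sub>L T}"

definition unital_star_subalgebra :: "'h::complex_hilbert op set \<Rightarrow> bool"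
  where "unital_star_subalgebra A \<longleftrightarrow>
    A \<subseteq> bounded_ops \<and>
    id_blinfun \<in> A \<and>
    (\<forall>x\<in>A. \<forall>y\<in>A. x + y \<in> A) \<and>
    (\<forall>x\<in>A. \<forall>y\<in>A. x o\<^sub>L y \<in> A) \<and>
    (\<forall>c. \<forall>x\<in>A. scaleC_op c x \<in> A) \<and>
    (\<forall>x\<in>A. \<exists>y\<in>A. is_adjoint x y)"

definition von_neumann_algebra :: "'h::complex_hilbert op set \<Rightarrow> bool"
  where "von_neumann_algebra A \<longleftrightarrow>
    unital_star_subalgebra A \<and> commutant (commutant A) = A"

definition factor :: "'h::complex_hilbert op set \<Rightarrow> bool"
  where "factor A \<longleftrightarrow>
    von_neumann_algebra A \<and> (id_blinfun :: 'h op) \<noteq> 0 \<and>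
    A \<inter> commutant A = range (\<lambda>c. scaleC_op c id_blinfun)"

text \<open>Murray--von Neumann finiteness of the identity: every isometry of the algebra is unitary.\<close>

definition finite_algebra :: "'h::complex_hilbert op set \<Rightarrow> bool"
  where "finite_algebra A \<longleftrightarrow>
    (\<forall>v\<in>A. \<forall>w\<in>A. is_adjoint v w \<and> w o\<^sub>L v = id_blinfun \<longrightarrow> v o\<^sub>L w = id_blinfun)"

definition minimal_projection :: "'h::complex_hilbert op set \<Rightarrow> 'h op \<Rightarrow> bool"
  where "minimal_projection A p \<longleftrightarrow>
    p \<in> A \<and> projection_op p \<and> p \<noteq> 0 \<and>
    (\<forall>q\<in>A. projection_op q \<and> op_le q p \<longrightarrow> q = 0 \<or> q = p)"

definition II1_factor :: "'h::complex_hilbert op set \<Rightarrow> bool"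
  where "II1_factor A \<longleftrightarrow>
    factor A \<and> finite_algebra A \<and> (\<nexists>p. minimal_projection A p)"

section \<open>Faithful normal tracial states\<close>

definition state_on :: "'h::complex_hilbert op set \<Rightarrow> ('h op \<Rightarrow> complex) \<Rightarrow> bool"
  where "state_on A \<tau> \<longleftrightarrow>
    (\<forall>x\<in>A. \<forall>y\<in>A. \<tau> (x + y) = \<tau> x + \<tau> y) \<and>
    (\<forall>c. \<forall>x\<in>A. \<tau> (scaleC_op c x) = c * \<tau> x) \<and>
    (\<forall>x\<in>A. positive_op x \<longrightarrow> \<tau> x \<in> \<real>\<^sub>\<ge>\<^sub>0) \<and>
    \<tau> id_blinfun = 1"

definition tracial_on :: "'h::complex_hilbert op set \<Rightarrow> ('h op \<Rightarrow> complex) \<Rightarrow> bool"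
  where "tracial_on A \<tau> \<longleftrightarrow> (\<forall>x\<in>A. \<forall>y\<in>A. \<tau> (x o\<^sub>L y) = \<tau> (y o\<^sub>L x))"

definition faithful_on :: "'h::complex_hilbert op set \<Rightarrow> ('h op \<Rightarrow> complex) \<Rightarrow> bool"
  where "faithful_on A \<tau> \<longleftrightarrow> (\<forall>x\<in>A. positive_op x \<and> \<tau> x = 0 \<longrightarrow> x = 0)"

text \<open>
  Normality in Dixmier's sense: suprema of upward directed sets of positive elements are preserved.
\<close>

definition normal_on :: "'h::complex_hilbert op set \<Rightarrow> ('h op \<Rightarrow> complex) \<Rightarrow> bool"
  where "normal_on A \<tau> \<longleftrightarrow>
    (\<forall>D s. D \<noteq> {} \<and> D \<subseteq> {x \<in> A. positive_op x} \<and>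
       (\<forall>x\<in>D. \<forall>y\<in>D. \<exists>z\<in>D. op_le x z \<and> op_le y z) \<and>
       s \<in> A \<and> (\<forall>x\<in>D. op_le x s) \<and>
       (\<forall>u\<in>A. (\<forall>x\<in>D. op_le x u) \<longrightarrow> op_le s u) \<longrightarrow>
       Re (\<tau> s) = (SUP x\<in>D. Re (\<tau> x)))"

definition faithful_normal_tracial_state ::
    "'h::complex_hilbert op set \<Rightarrow> ('h op \<Rightarrow> complex) \<Rightarrow> bool"
  where "faithful_normal_tracial_state A \<tau> \<longleftrightarrow>
    state_on A \<tau> \<and> tracial_on A \<tau> \<and> faithful_on A \<tau> \<and> normal_on A \<tau>"

section \<open>Voiculescu freeness\<close>

definition generated_star_algebra :: "'h::complex_hilbert op set \<Rightarrow> 'h op set"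
  where "generated_star_algebra S = \<Inter>{B. unital_star_subalgebra B \<and> S \<subseteq> B}"

text \<open>
  A word \<open>ws\<close> lists letters together with the index of the subalgebra they are taken from.
\<close>

definition free_subalgebras :: "('h::complex_hilbert op \<Rightarrow> complex) \<Rightarrow> ('i \<Rightarrow> 'h op set) \<Rightarrow> bool"
  where "free_subalgebras \<tau> B \<longleftrightarrow>
    (\<forall>ws :: ('i \<times> 'h op) list.
       ws \<noteq> [] \<and> (\<forall>(i, x) \<in> set ws. x \<in> B i \<and> \<tau> x = 0) \<and> distinct_adj (map fst ws) \<longrightarrow>
       \<tau> (foldr (o\<^sub>L) (map snd ws) id_blinfun) = 0)"

definition free_from :: "('h::complex_hilbert op \<Rightarrow> complex) \<Rightarrow> 'h op \<Rightarrow> 'h op \<Rightarrow> bool"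
  where "free_from \<tau> x y \<longleftrightarrow>
    free_subalgebras \<tau> (\<lambda>i::bool. generated_star_algebra (if i then {x} else {y}))"

section \<open>The quantities in the estimate\<close>

definition compression_norm :: "'h::complex_hilbert op \<Rightarrow> 'h op \<Rightarrow> real"
  where "compression_norm p a = norm (p o\<^sub>L a o\<^sub>L p)"

text \<open>
  For self-adjoint \<open>a\<close> and a state \<open>\<tau>\<close> the radicand is nonnegative, being the value of \<open>\<tau>\<close> at
  the square of \<open>a - \<tau>(a)\<close>, so this is the nonnegative root of the variance.
\<close>

definition std_dev :: "('h::complex_hilbert op \<Rightarrow> complex) \<Rightarrow> 'h op \<Rightarrow> real"
  where "std_dev \<tau> a = sqrt (Re (\<tau> (a o\<^sub>L a)) - (Re (\<tau> a))\<^sup>2)"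

definition eps :: "('h::complex_hilbert op \<Rightarrow> complex) \<Rightarrow> real \<Rightarrow> 'h op \<Rightarrow> real \<Rightarrow> real"
  where "eps \<tau> L a s =
    (if L + std_dev \<tau> a * sqrt (s - 1) = 0 then 0
     else std_dev \<tau> a * sqrt (s - 1) / (L + std_dev \<tau> a * sqrt (s - 1)))"

end

theory Submission
  imports Defs
begin

text \<open>
  For \<open>l > \<parallel>p a p\<parallel>\<close> let \<open>R\<close> be the inverse of \<open>l - p a p\<close> in the corner and \<open>\<phi> h = \<tau> (R h)\<close>,
  \<open>w = \<phi> 1\<close>. Let \<open>\<delta>\<close> be the derivation with \<open>\<delta> a = a \<otimes> 1 - 1 \<otimes> a\<close> and \<open>\<delta> p = 0\<close>; freeness of \<open>p\<close>
  and \<open>a\<close> gives \<open>(\<tau> \<otimes> \<tau>) \<circ> \<delta> = 0\<close>. Applied to \<open>R h\<close> with \<open>h\<close> a polynomial in \<open>a\<close>, this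
  yields the subordination identity \<open>\<phi> (h (x - a)) = \<tau> h\<close> with \<open>x = l + (1 - t) / w\<close>. Put
  \<open>h = 1 + (a - \<tau> a) / x\<close> and \<open>b = 1 - w h (x - a)\<close>. Then \<open>\<phi> (b\<^sup>2) \<ge> 0\<close> says
  \<open>1 / w \<le> \<tau> (h (x - a) h) \<le> x - \<tau> a - \<sigma>\<^sup>2 / x\<close>, where positivity of \<open>a\<close> enters through
  \<open>\<tau> ((a - \<tau> a) a (a - \<tau> a)) \<ge> 0\<close>. Hence
  \<open>l \<ge> t x + (1 - t) (\<tau> a + \<sigma>\<^sup>2 / x) \<ge> (1 - t) \<tau> a + 2 \<sigma> sqrt (t (1 - t))\<close>, which is stronger than
  the claim because \<open>\<epsilon> \<le> 1\<close> and \<open>L \<ge> 0\<close>.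
\<close>

section \<open>Inner products and self-adjoint operators\<close>

lemma scaleC_diff_right: "c *\<^sub>C (x - y :: 'a::complex_hilbert) = c *\<^sub>C x - c *\<^sub>C y"
  by (metis add_diff_cancel diff_add_cancel scaleC_add_right)

lemma cinner_add_right: "cinner x (y + z :: 'a::complex_hilbert) = cinner x y + cinner x z"
  by (metis cinner_add_left cinner_commute complex_cnj_add)

lemma cinner_scaleC_right: "cinner x (c *\<^sub>C y :: 'a::complex_hilbert) = cnj c * cinner x y"
  by (metis cinner_commute cinner_scaleC_left complex_cnj_mult)

lemma cinner_scaleR_left: "cinner (r *\<^sub>R x) (y :: 'a::complex_hilbert) = of_real r * cinner x y"
  by (simp add: scaleR_scaleC cinner_scaleC_left)

lemma cinner_scaleR_right: "cinner x (r *\<^sub>R y :: 'a::complex_hilbert) = of_real r * cinner x y"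
  by (simp add: scaleR_scaleC cinner_scaleC_right)

lemma cinner_minus_left: "cinner (- x) (y :: 'a::complex_hilbert) = - cinner x y"
  using cinner_scaleR_left[of "-1" x y] by simp

lemma cinner_minus_right: "cinner x (- y :: 'a::complex_hilbert) = - cinner x y"
  using cinner_scaleR_right[of x "-1" y] by simp

lemma cinner_diff_left: "cinner (x - y) (z :: 'a::complex_hilbert) = cinner x z - cinner y z"
  using cinner_add_left[of x "- y" z] by (simp add: cinner_minus_left)

lemma cinner_diff_right: "cinner x (y - z :: 'a::complex_hilbert) = cinner x y - cinner x z"
  using cinner_add_right[of x y "- z"] by (simp add: cinner_minus_right)

lemmas cinner_simps = cinner_add_left cinner_add_right cinner_scaleC_left cinner_scaleC_right
  cinner_scaleR_left cinner_scaleR_right cinner_diff_left cinner_diff_right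

lemma cinner_self_nonneg: "cinner x (x :: 'a::complex_hilbert) \<in> \<real>\<^sub>\<ge>\<^sub>0"
  by (simp flip: norm_cinner)

lemma scaleR_eq_scaleC_op: "r *\<^sub>R (T :: 'h::complex_hilbert op) = scaleC_op (of_real r) T"
  by (rule blinfun_eqI) (simp add: blinfun.scaleR_left scaleR_scaleC)

lemma diff_eq_scaleC_op: "(x :: 'h::complex_hilbert op) - y = x + scaleC_op (-1) y"
  using scaleR_eq_scaleC_op[of "-1" y] by simp

lemma blinfun_compose_assoc: "(x o\<^sub>L y) o\<^sub>L z = x o\<^sub>L (y o\<^sub>L z)"
  by (rule blinfun_eqI) simp

lemma id_blinfun_compose [simp]: "id_blinfun o\<^sub>L x = x" and compose_id_blinfun [simp]: "x o\<^sub>L id_blinfun = x"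
  by (rule blinfun_eqI, simp)+

text \<open>Over the complex field, polarization makes a real quadratic form Hermitian.\<close>

lemma positive_op_self_adjoint:
  fixes a :: "'h::complex_hilbert op"
  assumes "a \<in> bounded_ops" "positive_op a"
  shows "is_adjoint a a"
  unfolding is_adjoint_def
proof (intro allI)
  fix x y
  define S where "S x y = cinner (a x) y - cinner x (a y)" for x y
  have S0: "S x x = 0" for x
    using assms(2) cinner_commute[of x "a x"]
    by (auto simp: S_def positive_op_def complex_nonneg_Reals_iff complex_eq_iff)
  have 1: "S x y + S y x = 0" for x y
    using S0[of "x + y"] S0[of x] S0[of y]
    by (simp add: S_def cinner_simps blinfun.add_right algebra_simps)
  have 2: "S (\<i> *\<^sub>C x) y = \<i> * S x y" "S y (\<i> *\<^sub>C x) = - \<i> * S y x"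
    using assms(1) by (simp_all add: S_def cinner_simps bounded_ops_def algebra_simps)
  have "\<i> * (S x y - S y x) = 0"
    using 1[of "\<i> *\<^sub>C x" y] unfolding 2 by (simp add: algebra_simps)
  then have "S x y = 0"
    using 1[of x y] by simp
  then show "cinner (a x) y = cinner x (a y)"
    by (simp add: S_def)
qed

section \<open>Calculus of adjoints and positive operators\<close>

lemma is_adjoint_sym: "is_adjoint x y \<Longrightarrow> is_adjoint y x"
  unfolding is_adjoint_def by (metis cinner_commute)

lemma is_adjoint_compose:
  "is_adjoint x x' \<Longrightarrow> is_adjoint y y' \<Longrightarrow> is_adjoint (x o\<^sub>L y) (y' o\<^sub>L x')"
  by (simp add: is_adjoint_def)

lemma is_adjoint_diff:
  "is_adjoint x x' \<Longrightarrow> is_adjoint y y' \<Longrightarrow> is_adjoint (x - y) (x' - y')"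
  by (simp add: is_adjoint_def blinfun.diff_left cinner_simps)

lemma is_adjoint_add:
  "is_adjoint x x' \<Longrightarrow> is_adjoint y y' \<Longrightarrow> is_adjoint (x + y) (x' + y')"
  by (simp add: is_adjoint_def blinfun.add_left cinner_simps)

lemma is_adjoint_scaleC_op:
  "is_adjoint x x' \<Longrightarrow> is_adjoint (scaleC_op c x) (scaleC_op (cnj c) x')"
  by (simp add: is_adjoint_def cinner_simps)

lemma is_adjoint_scaleR:
  "is_adjoint x x' \<Longrightarrow> is_adjoint (r *\<^sub>R x) (r *\<^sub>R x' :: 'h::complex_hilbert op)"
  by (simp add: is_adjoint_def blinfun.scaleR_left cinner_simps)

lemma is_adjoint_id: "is_adjoint id_blinfun id_blinfun"
  by (simp add: is_adjoint_def)

lemma positive_op_conj: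
  assumes "positive_op x" "is_adjoint y y'"
  shows "positive_op (y' o\<^sub>L x o\<^sub>L y)"
  using assms(1) is_adjoint_sym[OF assms(2)] by (simp add: positive_op_def is_adjoint_def)

lemma positive_op_id: "positive_op id_blinfun"
  by (simp add: positive_op_def cinner_self_nonneg)

text \<open>As a quadratic form this is the operator norm bound for \<open>x v\<close>. It makes
  norm bounds available to states, which see only positivity.\<close>

lemma positive_op_norm_square_diff:
  fixes x :: "'h::complex_hilbert op"
  assumes "is_adjoint x x'"
  shows "positive_op ((norm x)\<^sup>2 *\<^sub>R id_blinfun - (x' o\<^sub>L x))"
  unfolding positive_op_def
proof
  fix v
  have "cinner (((norm x)\<^sup>2 *\<^sub>R id_blinfun - (x' o\<^sub>L x)) v) v = of_real ((norm x)\<^sup>2 * (norm v)\<^sup>2 - (norm (x v))\<^sup>2)"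
    using is_adjoint_sym[OF assms] norm_cinner[of v] norm_cinner[of "x v"]
    by (simp add: is_adjoint_def blinfun.diff_left blinfun.scaleR_left cinner_simps)
  moreover have "(norm (x v))\<^sup>2 \<le> (norm x * norm v)\<^sup>2"
    by (simp add: norm_blinfun power_mono)
  ultimately show "cinner (((norm x)\<^sup>2 *\<^sub>R id_blinfun - (x' o\<^sub>L x)) v) v \<in> \<real>\<^sub>\<ge>\<^sub>0"
    by (simp only: nonneg_Reals_of_real_iff) (simp add: power_mult_distrib)
qed

section \<open>Tracial states\<close>

text \<open>The closure rules shared by \<open>A\<close> and the generated algebras, so that one set
  of introduction rules serves both.\<close>

definition unital_subalgebra :: "'h::complex_hilbert op set \<Rightarrow> bool"
  where "unital_subalgebra B \<longleftrightarrow>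
    id_blinfun \<in> B \<and>
    (\<forall>x\<in>B. \<forall>y\<in>B. x + y \<in> B) \<and>
    (\<forall>x\<in>B. \<forall>y\<in>B. x o\<^sub>L y \<in> B) \<and>
    (\<forall>c. \<forall>x\<in>B. scaleC_op c x \<in> B)"

lemma unital_star_subalgebraD: "unital_star_subalgebra B \<Longrightarrow> unital_subalgebra B"
  by (simp add: unital_star_subalgebra_def unital_subalgebra_def)

lemma unital_subalgebra_generated: "unital_subalgebra (generated_star_algebra S)"
  unfolding unital_subalgebra_def generated_star_algebra_def unital_star_subalgebra_def by blast

context
  fixes B :: "'h::complex_hilbert op set"
  assumes B: "unital_subalgebra B"
begin

lemma subalgebra_id: "id_blinfun \<in> B"
  and subalgebra_add: "x \<in> B \<Longrightarrow> y \<in> B \<Longrightarrow> x + y \<in> B"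
  and subalgebra_compose: "x \<in> B \<Longrightarrow> y \<in> B \<Longrightarrow> x o\<^sub>L y \<in> B"
  and subalgebra_scaleC: "x \<in> B \<Longrightarrow> scaleC_op c x \<in> B"
  using B by (auto simp: unital_subalgebra_def)

lemma subalgebra_scaleR: "x \<in> B \<Longrightarrow> r *\<^sub>R x \<in> B"
  unfolding scaleR_eq_scaleC_op by (rule subalgebra_scaleC)

lemma subalgebra_diff: "x \<in> B \<Longrightarrow> y \<in> B \<Longrightarrow> x - y \<in> B"
  unfolding diff_eq_scaleC_op by (intro subalgebra_add subalgebra_scaleC)

lemmas subalgebra_intros = subalgebra_id subalgebra_add subalgebra_compose subalgebra_scaleC
  subalgebra_scaleR subalgebra_diff

end

locale tracial_state =
  fixes A :: "'h::complex_hilbert op set" and \<tau> :: "'h op \<Rightarrow> complex"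
  assumes subalgebra: "unital_star_subalgebra A"
    and state: "state_on A \<tau>"
    and tracial: "tracial_on A \<tau>"
begin

lemmas A_intros [intro] = subalgebra_intros[OF unital_star_subalgebraD[OF subalgebra]]

lemma A_bounded: "x \<in> A \<Longrightarrow> x \<in> bounded_ops"
  using subalgebra by (auto simp: unital_star_subalgebra_def)

lemma tau_add: "x \<in> A \<Longrightarrow> y \<in> A \<Longrightarrow> \<tau> (x + y) = \<tau> x + \<tau> y"
  and tau_scaleC: "x \<in> A \<Longrightarrow> \<tau> (scaleC_op c x) = c * \<tau> x"
  and tau_positive: "x \<in> A \<Longrightarrow> positive_op x \<Longrightarrow> \<tau> x \<in> \<real>\<^sub>\<ge>\<^sub>0"
  and tau_id: "\<tau> id_blinfun = 1"
  using state by (auto simp: state_on_def)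

lemma tau_scaleR: "x \<in> A \<Longrightarrow> \<tau> (r *\<^sub>R x) = of_real r * \<tau> x"
  by (simp add: scaleR_eq_scaleC_op tau_scaleC)

lemma tau_diff: "x \<in> A \<Longrightarrow> y \<in> A \<Longrightarrow> \<tau> (x - y) = \<tau> x - \<tau> y"
  by (simp add: diff_eq_scaleC_op tau_add tau_scaleC A_intros)

lemma tau_commute: "x \<in> A \<Longrightarrow> y \<in> A \<Longrightarrow> \<tau> (x o\<^sub>L y) = \<tau> (y o\<^sub>L x)"
  using tracial by (auto simp: tracial_on_def)

lemmas tau_simps = tau_add tau_diff tau_scaleC tau_scaleR tau_id

text \<open>Cauchy-Schwarz against the identity: positivity on the square of \<open>x - c\<close>,
  taken at \<open>c = \<tau> x\<close>, bounds the squared modulus of \<open>\<tau> x\<close> by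
  \<open>\<tau> (x' o\<^sub>L x)\<close>, and this is at most the squared norm.\<close>

lemma cmod_tau_le_norm:
  assumes x: "x \<in> A"
  shows "cmod (\<tau> x) \<le> norm x"
proof -
  obtain x' where x': "x' \<in> A" "is_adjoint x x'"
    using x subalgebra by (auto simp: unital_star_subalgebra_def)
  have pos: "\<tau> (x' o\<^sub>L x) - c * \<tau> x' - cnj c * \<tau> x + cnj c * c \<in> \<real>\<^sub>\<ge>\<^sub>0" for c
  proof -
    define y where "y = x - scaleC_op c id_blinfun"
    define y' where "y' = x' - scaleC_op (cnj c) id_blinfun"
    have "is_adjoint y y'"
      unfolding y_def y'_def by (intro is_adjoint_diff is_adjoint_scaleC_op is_adjoint_id x')
    then have "positive_op (y' o\<^sub>L y)"
      using positive_op_conj[OF positive_op_id] by simp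
    moreover have eq: "y' o\<^sub>L y = (x' o\<^sub>L x) - scaleC_op c x' - scaleC_op (cnj c) x + scaleC_op (cnj c * c) id_blinfun"
      using A_bounded[OF x'(1)]
      by (intro blinfun_eqI)
         (simp add: y_def y'_def blinfun.diff_left blinfun.diff_right blinfun.add_left bounded_ops_def
            scaleC_scaleC scaleC_diff_right)
    ultimately have "\<tau> (y' o\<^sub>L y) \<in> \<real>\<^sub>\<ge>\<^sub>0"
      by (intro tau_positive) (use x x' in \<open>auto simp: y_def y'_def\<close>)
    also have "\<tau> (y' o\<^sub>L y) = \<tau> (x' o\<^sub>L x) - c * \<tau> x' - cnj c * \<tau> x + cnj c * c"
      unfolding eq using x x' by (simp add: tau_simps A_intros)
    finally show ?thesis .
  qed
  \<comment> \<open>The expressions at \<open>c = 0\<close>, \<open>1\<close> and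
    \<open>\<i>\<close> are real; comparing imaginary parts determines both parts of
    \<open>\<tau> x'\<close>.\<close>
  have "\<tau> x' = cnj (\<tau> x)"
    using pos[of 0] pos[of 1] pos[of "\<i>"] by (simp add: complex_nonneg_Reals_iff complex_eq_iff)
  then have *: "Re (\<tau> (x' o\<^sub>L x)) \<ge> (cmod (\<tau> x))\<^sup>2"
    using pos[of "\<tau> x"] unfolding cmod_power2
    by (simp add: complex_nonneg_Reals_iff power2_eq_square algebra_simps)
  have "\<tau> ((norm x)\<^sup>2 *\<^sub>R id_blinfun - (x' o\<^sub>L x)) \<in> \<real>\<^sub>\<ge>\<^sub>0"
    using x x' by (intro tau_positive positive_op_norm_square_diff) auto
  then have "Re (\<tau> (x' o\<^sub>L x)) \<le> (norm x)\<^sup>2"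
    using x x' by (simp add: tau_simps A_intros complex_nonneg_Reals_iff power2_eq_square)
  with * have "(cmod (\<tau> x))\<^sup>2 \<le> (norm x)\<^sup>2"
    by linarith
  then show ?thesis
    by (rule power2_le_imp_le) simp
qed

end

section \<open>The derivation identity for free subalgebras\<close>

abbreviation word :: "('i \<times> 'h op) list \<Rightarrow> 'h::complex_hilbert op"
  where "word ws \<equiv> foldr (o\<^sub>L) (map snd ws) id_blinfun"

text \<open>
  With \<open>x = id_blinfun\<close> this is \<open>\<tau> \<otimes> \<tau>\<close> of the derivation that is \<open>y \<mapsto> y \<otimes> 1 - 1 \<otimes> y\<close> on the
  algebra with index \<^const>\<open>False\<close> and zero on the one with index \<^const>\<open>True\<close>; in general
  \<open>x\<close> stands for the part of the word that has already been read.
\<close>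

fun deriv_trace ::
    "('h::complex_hilbert op \<Rightarrow> complex) \<Rightarrow> 'h op \<Rightarrow> (bool \<times> 'h op) list \<Rightarrow> complex"
  where
    "deriv_trace \<tau> x [] = 0"
  | "deriv_trace \<tau> x ((i, y) # ws) =
       (if i then 0 else \<tau> (x o\<^sub>L y) * \<tau> (word ws) - \<tau> x * \<tau> (y o\<^sub>L word ws))
       + deriv_trace \<tau> (x o\<^sub>L y) ws"

locale free_pair = tracial_state A \<tau>
  for A :: "'h::complex_hilbert op set" and \<tau> +
  fixes B :: "bool \<Rightarrow> 'h op set"
  assumes B_subalgebra: "unital_subalgebra (B i)"
    and B_subset: "B i \<subseteq> A"
    and free: "free_subalgebras \<tau> B"
begin

definition letters :: "(bool \<times> 'h op) list \<Rightarrow> bool"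
  where "letters ws \<longleftrightarrow> (\<forall>(i, x) \<in> set ws. x \<in> B i)"

lemma letters_simps [simp]:
  "letters []" "letters (w # ws) \<longleftrightarrow> snd w \<in> B (fst w) \<and> letters ws"
  "letters (us @ ws) \<longleftrightarrow> letters us \<and> letters ws"
  by (auto simp: letters_def)

lemma word_append: "word (us @ ws) = word us o\<^sub>L word ws"
  by (induction us) (simp_all add: blinfun_compose_assoc)

lemma B_A [intro]: "x \<in> B i \<Longrightarrow> x \<in> A"
  using B_subset by auto

lemma word_in_A: "letters ws \<Longrightarrow> word ws \<in> A"
  by (induction ws) auto

section \<open>Rewriting words under the derivation trace\<close>

lemma deriv_trace_linear:
  assumes "x \<in> A" "y \<in> A" "letters ws"
  shows "deriv_trace \<tau> (scaleC_op c x + y) ws = c * deriv_trace \<tau> x ws + deriv_trace \<tau> y ws"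
  using assms
proof (induction ws arbitrary: x y)
  case (Cons w ws)
  obtain i z where w: "w = (i, z)" by force
  have z: "z \<in> A" using Cons.prems w by auto
  have "(scaleC_op c x + y) o\<^sub>L z = scaleC_op c (x o\<^sub>L z) + (y o\<^sub>L z)"
    by (rule blinfun_eqI) (simp add: blinfun.add_left)
  then show ?case
    using Cons z by (simp add: w tau_simps A_intros algebra_simps)
qed simp

text \<open>The letters of \<open>us\<close> see the tail only through its product, so a rewriting
  valid for every prefix value stays valid inside a longer word.\<close>

lemma deriv_trace_cong_append:
  assumes "\<And>x. x \<in> A \<Longrightarrow> deriv_trace \<tau> x ws = deriv_trace \<tau> x ws'" "word ws = word ws'"
    and "letters us" "x \<in> A"
  shows "deriv_trace \<tau> x (us @ ws) = deriv_trace \<tau> x (us @ ws')"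
  using assms(3-)
proof (induction us arbitrary: x)
  case (Cons u us)
  obtain i z where u: "u = (i, z)" by force
  have z: "z \<in> A" using Cons.prems u by auto
  have "word (us @ ws) = word (us @ ws')"
    unfolding word_append assms(2) ..
  then show ?case
    using Cons z by (simp add: u A_intros)
qed (simp add: assms(1))

text \<open>Leibniz rule: for index \<open>False\<close> the two products that cut the word between
  \<open>y\<close> and \<open>z\<close> cancel; for \<open>True\<close> neither letter
  contributes.\<close>

lemma deriv_trace_merge:
  assumes "letters us" "x \<in> A"
  shows "deriv_trace \<tau> x (us @ (i, y) # (i, z) # ws) = deriv_trace \<tau> x (us @ (i, y o\<^sub>L z) # ws)"
  by (rule deriv_trace_cong_append) (use assms in \<open>simp_all add: blinfun_compose_assoc\<close>)

lemma word_split_letter: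
  assumes "letters us"
  shows "word (us @ (i, y) # ws) = scaleC_op c (word (us @ ws)) + word (us @ (i, y - scaleC_op c id_blinfun) # ws)"
  using A_bounded[OF word_in_A[OF assms]] unfolding word_append
  by (intro blinfun_eqI) (simp add: blinfun.add_left blinfun.diff_left blinfun.diff_right bounded_ops_def)

text \<open>A derivation annihilates scalars, so the scalar part of the letter contributes just
  \<open>c\<close> times the value on the word without that letter.\<close>

lemma deriv_trace_split_letter:
  assumes "letters us" "letters ((i, y) # ws)" "x \<in> A"
  shows "deriv_trace \<tau> x (us @ (i, y) # ws) =
    c * deriv_trace \<tau> x (us @ ws) + deriv_trace \<tau> x (us @ (i, y - scaleC_op c id_blinfun) # ws)"
  using assms
proof (induction us arbitrary: x)
  case Nil
  define z where "z = y - scaleC_op c id_blinfun"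
  have A: "y \<in> A" "z \<in> A" "word ws \<in> A" using Nil by (auto simp: z_def word_in_A)
  have eq: "x o\<^sub>L y = scaleC_op c x + (x o\<^sub>L z)" "y o\<^sub>L word ws = scaleC_op c (word ws) + (z o\<^sub>L word ws)"
    using A_bounded[OF Nil(3)]
    by (auto intro!: blinfun_eqI simp: z_def blinfun.add_left blinfun.diff_left blinfun.diff_right bounded_ops_def)
  have lin: "deriv_trace \<tau> (scaleC_op c x + (x o\<^sub>L z)) ws = c * deriv_trace \<tau> x ws + deriv_trace \<tau> (x o\<^sub>L z) ws"
    using Nil A by (intro deriv_trace_linear) auto
  show ?case
    unfolding z_def[symmetric] append_Nil deriv_trace.simps eq lin
    using Nil A by (simp add: tau_simps A_intros algebra_simps)
next
  case (Cons u us)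
  obtain j z where u: "u = (j, z)" by force
  have [intro]: "z \<in> A" using Cons.prems u by auto
  have L: "letters us" "y \<in> A" "letters ws" using Cons.prems by auto
  have A: "word (us @ ws) \<in> A" "word (us @ (i, y - scaleC_op c id_blinfun) # ws) \<in> A"
    using L word_in_A[of us] word_in_A[of ws] unfolding word_append by (simp_all add: A_intros)
  have eq: "z o\<^sub>L word (us @ (i, y) # ws) = 
      scaleC_op c (z o\<^sub>L word (us @ ws)) + (z o\<^sub>L word (us @ (i, y - scaleC_op c id_blinfun) # ws))"
    using word_split_letter[of "u # us" i y ws c] Cons.prems by (simp add: u)
  have IH: "deriv_trace \<tau> (x o\<^sub>L z) (us @ (i, y) # ws) =
    c * deriv_trace \<tau> (x o\<^sub>L z) (us @ ws) + deriv_trace \<tau> (x o\<^sub>L z) (us @ (i, y - scaleC_op c id_blinfun) # ws)"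
    using Cons by (auto simp: u)
  show ?case
    unfolding u append_Cons deriv_trace.simps eq IH
    unfolding word_split_letter[OF L(1), of i y ws c]
    using Cons.prems A by (simp add: tau_simps A_intros \<open>z \<in> A\<close> algebra_simps)
qed

section \<open>Vanishing of the derivation trace by freeness\<close>

lemma tau_alternating:
  assumes "ws \<noteq> []" "letters ws" "\<forall>w\<in>set ws. \<tau> (snd w) = 0" "distinct_adj (map fst ws)"
  shows "\<tau> (word ws) = 0"
  using free assms unfolding free_subalgebras_def letters_def by (auto simp: case_prod_beta)

text \<open>In each product the factor that contains the current letter is the trace of a nonempty
  centred alternating word, hence zero by freeness, whatever the other factor is.\<close>

lemma deriv_trace_alternating:
  assumes "letters (us @ ws)" "\<forall>w\<in>set (us @ ws). \<tau> (snd w) = 0" "distinct_adj (map fst (us @ ws))"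
  shows "deriv_trace \<tau> (word us) ws = 0"
  using assms
proof (induction ws arbitrary: us)
  case (Cons w ws)
  obtain i y where w: "w = (i, y)" by force
  have [simp]: "word us o\<^sub>L y = word (us @ [w])"
    unfolding word_append by (simp add: w)
  have "\<tau> (word (us @ [w])) = 0"
    using Cons.prems by (intro tau_alternating) (auto simp: distinct_adj_append_iff)
  moreover have "\<tau> (word (w # ws)) = 0"
    using Cons.prems by (intro tau_alternating) (auto simp: distinct_adj_append_iff)
  moreover have "deriv_trace \<tau> (word (us @ [w])) ws = 0"
    using Cons.prems by (intro Cons.IH) auto
  ultimately show ?case
    by (auto simp: w simp del: foldr_append map_append)
qed simp

lemma not_distinct_adj_decomp:
  "\<not> distinct_adj (map fst ws) \<Longrightarrow> \<exists>us i y z vs. ws = us @ (i, y) # (i, z) # vs"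
proof (induction ws)
  case (Cons w ws)
  show ?case
  proof (cases "distinct_adj (map fst ws)")
    case True
    then obtain w' vs where "ws = w' # vs" "fst w = fst w'"
      using Cons.prems by (cases ws) (auto simp: distinct_adj_Cons)
    then have "w # ws = [] @ (fst w, snd w) # (fst w, snd w') # vs"
      by (cases w; cases w') simp
    then show ?thesis by blast
  next
    case False
    then show ?thesis using Cons.IH by (metis append_Cons)
  qed
qed simp

text \<open>Every word reduces to centred alternating ones: merge neighbours of equal index, or
  split off the mean of a letter. The measure is lexicographic: length first, then the number of
  letters of nonzero trace.\<close>

theorem deriv_trace_zero: "letters ws \<Longrightarrow> deriv_trace \<tau> id_blinfun ws = 0"
proof (induction ws rule: wf_induct_rule[OF wf_measures[of "[length, \<lambda>ws. length (filter (\<lambda>w. \<tau> (snd w) \<noteq> 0) ws)]"]])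
  case (1 ws)
  consider us i y z vs where "ws = us @ (i, y) # (i, z) # vs"
    | w where "w \<in> set ws" "\<tau> (snd w) \<noteq> 0"
    | "distinct_adj (map fst ws)" "\<forall>w\<in>set ws. \<tau> (snd w) = 0"
    using not_distinct_adj_decomp by blast
  then show ?case
  proof cases
    case (1 us i y z vs)
    have "deriv_trace \<tau> id_blinfun (us @ (i, y o\<^sub>L z) # vs) = 0"
      using "1.prems" subalgebra_compose[OF B_subalgebra[of i]] by (intro "1.IH") (auto simp: 1)
    then show ?thesis
      using "1.prems" deriv_trace_merge[of us id_blinfun i y z vs] by (auto simp: 1)
  next
    case (2 w)
    then obtain us vs i y where ws: "ws = us @ (i, y) # vs" and y: "\<tau> y \<noteq> 0"
      by (metis split_list prod.collapse snd_conv)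
    define z where "z = y - scaleC_op (\<tau> y) id_blinfun"
    have yB: "y \<in> B i" using "1.prems" by (simp add: ws)
    have z: "\<tau> z = 0" "z \<in> B i"
      using yB unfolding z_def
      by (auto simp: tau_simps A_intros B_A intro!: subalgebra_intros[OF B_subalgebra])
    \<comment> \<open>Dropping the letter shortens the word; centring it keeps the length and lowers
      the second component of the measure.\<close>
    have "deriv_trace \<tau> id_blinfun (us @ vs) = 0"
      using "1.prems" by (intro "1.IH") (auto simp: ws)
    moreover have "deriv_trace \<tau> id_blinfun (us @ (i, z) # vs) = 0"
      using "1.prems" z y by (intro "1.IH") (auto simp: ws)
    ultimately show ?thesis
      using deriv_trace_split_letter[of us i y vs id_blinfun "\<tau> y"] "1.prems"
      by (auto simp: ws z_def)
  next
    case 3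
    then show ?thesis
      using deriv_trace_alternating[of "[]" ws] "1.prems" by simp
  qed
qed

end

section \<open>The resolvent of the compression\<close>

locale free_compression = tracial_state A \<tau>
  for A :: "'h::complex_hilbert op set" and \<tau> +
  fixes p a :: "'h op" and t :: real
  assumes pA: "p \<in> A" and aA: "a \<in> A"
    and proj: "projection_op p" and pos: "positive_op a"
    and tau_p: "\<tau> p = of_real t"
    and free_pa: "free_from \<tau> p a"
begin

text \<open>Index \<open>True\<close> carries \<open>p\<close>, so the derivation behind
  \<open>deriv_trace\<close> kills \<open>p\<close> and differentiates \<open>a\<close>.\<close>

sublocale free_pair A \<tau> "\<lambda>i. generated_star_algebra (if i then {p} else {a})"
proof
  show "generated_star_algebra (if i then {p} else {a}) \<subseteq> A" for i
    using subalgebra pA aA by (auto simp: generated_star_algebra_def)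
  show "free_subalgebras \<tau> (\<lambda>i. generated_star_algebra (if i then {p} else {a}))"
    using free_pa by (simp add: free_from_def)
qed (rule unital_subalgebra_generated)

abbreviation N :: real where "N \<equiv> compression_norm p a"

abbreviation alg_a :: "'h op set" where "alg_a \<equiv> generated_star_algebra {a}"

lemma alg_a_A [intro]: "h \<in> alg_a \<Longrightarrow> h \<in> A"
  using B_A[of h False] by simp

lemma a_alg_a: "a \<in> alg_a"
  by (simp add: generated_star_algebra_def)

lemma p_alg_p: "p \<in> generated_star_algebra {p}"
  by (simp add: generated_star_algebra_def)

lemma p_idem: "p o\<^sub>L p = p" and p_adjoint: "is_adjoint p p"
  using proj by (simp_all add: projection_op_def)

lemma a_adjoint: "is_adjoint a a"
  using positive_op_self_adjoint[OF A_bounded[OF aA] pos] .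

lemma tau_a_real: "\<tau> a = of_real (Re (\<tau> a))"
  using tau_positive[OF aA pos] by (simp add: complex_eq_iff complex_nonneg_Reals_iff)

text \<open>\<open>v\<close> is self-adjoint, so the radicand in \<open>std_dev\<close> is
  nonnegative and the square root can be undone.\<close>

lemma tau_centred_square:
  defines "v \<equiv> a - Re (\<tau> a) *\<^sub>R id_blinfun"
  shows "Re (\<tau> (v o\<^sub>L v)) = (std_dev \<tau> a)\<^sup>2" and "0 \<le> std_dev \<tau> a"
proof -
  define m where "m = Re (\<tau> a)"
  have "is_adjoint v v"
    unfolding v_def by (intro is_adjoint_diff is_adjoint_scaleR is_adjoint_id a_adjoint)
  moreover have "v \<in> A"
    using aA by (auto simp: v_def)
  ultimately have "0 \<le> Re (\<tau> (v o\<^sub>L v))"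
    using tau_positive[of "v o\<^sub>L v"] positive_op_conj[OF positive_op_id, of v v]
    by (auto simp: complex_nonneg_Reals_iff)
  moreover have "Re (\<tau> (v o\<^sub>L v)) = Re (\<tau> (a o\<^sub>L a)) - m\<^sup>2"
  proof -
    have "v o\<^sub>L v = (a o\<^sub>L a) - (2 * m) *\<^sub>R a + m\<^sup>2 *\<^sub>R id_blinfun"
      unfolding v_def m_def[symmetric]
      by (rule blinfun_eqI)
         (simp add: blinfun.bilinear_simps algebra_simps power2_eq_square flip: scaleR_2)
    then show ?thesis
      using aA by (simp add: tau_simps A_intros power2_eq_square m_def)
  qed
  ultimately show "Re (\<tau> (v o\<^sub>L v)) = (std_dev \<tau> a)\<^sup>2" and "0 \<le> std_dev \<tau> a"
    by (simp_all add: std_dev_def m_def)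
qed

section \<open>Powers of \<open>p a p\<close> in the corner algebra with unit
  \<open>p\<close>\<close>

primrec comp_pow :: "nat \<Rightarrow> 'h op" where
  "comp_pow 0 = p"
| "comp_pow (Suc n) = comp_pow n o\<^sub>L a o\<^sub>L p"

lemma comp_pow_in_A [intro]: "comp_pow n \<in> A"
  by (induction n) (use pA aA in auto)

lemma comp_pow_p: "comp_pow n o\<^sub>L p = comp_pow n"
  by (cases n) (simp_all add: blinfun_compose_assoc p_idem)

lemma p_comp_pow: "p o\<^sub>L comp_pow n = comp_pow n"
  by (induction n) (simp_all add: p_idem flip: blinfun_compose_assoc)

lemma comp_pow_Suc_left: "comp_pow (Suc n) = p o\<^sub>L (a o\<^sub>L comp_pow n)"
  by (induction n) (simp_all add: blinfun_compose_assoc)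

lemma comp_pow_Suc_norm: "comp_pow (Suc n) = (p o\<^sub>L a o\<^sub>L p) o\<^sub>L comp_pow n"
  by (simp only: comp_pow_Suc_left blinfun_compose_assoc p_comp_pow)

lemma norm_comp_pow: "norm (comp_pow n) \<le> N ^ n * norm p"
proof (induction n)
  case (Suc n)
  have "norm (comp_pow (Suc n)) \<le> N * norm (comp_pow n)"
    unfolding comp_pow_Suc_norm compression_norm_def by (rule norm_blinfun_compose)
  also have "\<dots> \<le> N * (N ^ n * norm p)"
    by (intro mult_left_mono Suc) (simp add: compression_norm_def)
  finally show ?case by (simp add: mult.assoc)
qed simp

text \<open>Conjugation by \<open>p a p\<close> raises the power by two, so the powers 0 and 1
  suffice; the latter is positive because \<open>a\<close> is.\<close>

lemma positive_comp_pow: "positive_op (comp_pow n)"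
proof (induction n rule: induct_nat_012)
  case 0
  show ?case
    using positive_op_conj[OF positive_op_id p_adjoint] by (simp add: p_idem)
next
  case 1
  show ?case
    using positive_op_conj[OF pos p_adjoint] by simp
next
  case (ge2 n)
  have "is_adjoint (p o\<^sub>L a o\<^sub>L p) (p o\<^sub>L a o\<^sub>L p)"
    using is_adjoint_compose[OF is_adjoint_compose[OF p_adjoint a_adjoint] p_adjoint]
    by (simp add: blinfun_compose_assoc)
  from positive_op_conj[OF ge2(1) this] have "positive_op ((p o\<^sub>L a o\<^sub>L p) o\<^sub>L comp_pow n o\<^sub>L (p o\<^sub>L a o\<^sub>L p))" .
  also have "(p o\<^sub>L a o\<^sub>L p) o\<^sub>L comp_pow n o\<^sub>L (p o\<^sub>L a o\<^sub>L p) = comp_pow (Suc n) o\<^sub>L p o\<^sub>L a o\<^sub>L p"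
    by (simp only: comp_pow_Suc_norm blinfun_compose_assoc)
  also have "\<dots> = comp_pow (Suc (Suc n))"
    by (simp only: comp_pow_p comp_pow.simps(2)[of "Suc n"])
  finally show ?case .
qed

section \<open>The derivation identity on words \<open>p a p a ... p h\<close>\<close>

primrec comp_word :: "nat \<Rightarrow> 'h op \<Rightarrow> (bool \<times> 'h op) list" where
  "comp_word 0 h = [(True, p), (False, h)]"
| "comp_word (Suc n) h = (True, p) # (False, a) # comp_word n h"

lemma word_comp_word: "word (comp_word n h) = comp_pow n o\<^sub>L h"
proof (induction n)
  case (Suc n)
  then show ?case
    by (simp add: comp_pow_Suc_left blinfun_compose_assoc del: comp_pow.simps(2))
qed simp

text \<open>Leibniz rule along the word: the summands come from the letters \<open>a\<close>, the
  last two terms from \<open>h\<close>, read as one letter. \<open>k\<close> is the power already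
  accumulated in the prefix; traciality moves \<open>a\<close> from the front of the remaining word
  behind \<open>h\<close>.\<close>

lemma deriv_trace_comp_word:
  assumes "x o\<^sub>L p = comp_pow k" "x \<in> A" "h \<in> alg_a"
  shows "deriv_trace \<tau> x (comp_word n h) =
    (\<Sum>j<n. \<tau> (comp_pow (k + j) o\<^sub>L a) * \<tau> (comp_pow (n - Suc j) o\<^sub>L h)
        - \<tau> (comp_pow (k + j)) * \<tau> (comp_pow (n - Suc j) o\<^sub>L (h o\<^sub>L a)))
    + \<tau> (comp_pow (k + n) o\<^sub>L h) - \<tau> (comp_pow (k + n)) * \<tau> h"
  using assms(1,2)
proof (induction n arbitrary: x k)
  case 0
  then show ?case by (simp add: tau_id)
next
  case (Suc n)
  have "x o\<^sub>L p o\<^sub>L a o\<^sub>L p = comp_pow (Suc k)" "x o\<^sub>L p o\<^sub>L a \<in> A"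
    using Suc.prems pA aA by auto
  note IH = Suc.IH[OF this, unfolded Suc.prems(1)]
  have "\<tau> (a o\<^sub>L (comp_pow n o\<^sub>L h)) = \<tau> (comp_pow n o\<^sub>L (h o\<^sub>L a))"
    using tau_commute[of a "comp_pow n o\<^sub>L h"] assms(3) aA by (auto simp: blinfun_compose_assoc)
  then show ?case
    unfolding sum.lessThan_Suc_shift
    by (simp add: IH word_comp_word Suc.prems(1) comp_pow.simps(2)[symmetric] del: comp_pow.simps(2))
qed

lemma comp_pow_derivation_identity:
  assumes "h \<in> alg_a"
  shows "(\<Sum>j<n. \<tau> (comp_pow j o\<^sub>L a) * \<tau> (comp_pow (n - Suc j) o\<^sub>L h)
        - \<tau> (comp_pow j) * \<tau> (comp_pow (n - Suc j) o\<^sub>L (h o\<^sub>L a)))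
    + \<tau> (comp_pow n o\<^sub>L h) - \<tau> (comp_pow n) * \<tau> h = 0"
proof -
  have "letters (comp_word n h)"
    by (induction n) (use assms a_alg_a in \<open>simp_all add: p_alg_p\<close>)
  then show ?thesis
    using deriv_trace_zero[of "comp_word n h"] deriv_trace_comp_word[of id_blinfun 0 h n] assms
    by (auto simp: A_intros)
qed

section \<open>The resolvent functional and its Neumann series\<close>

definition res_coeff :: "real \<Rightarrow> 'h op \<Rightarrow> nat \<Rightarrow> complex"
  where "res_coeff l h n = \<tau> (comp_pow n o\<^sub>L h) / of_real l ^ Suc n"

text \<open>This is \<open>\<tau> (R h)\<close> for the inverse \<open>R\<close> of \<open>l - p a p\<close> in the corner, by Neumann series.\<close>

definition res :: "real \<Rightarrow> 'h op \<Rightarrow> complex"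
  where "res l h = (\<Sum>n. res_coeff l h n)"

context
  fixes l :: real
  assumes l: "N < l"
begin

lemma l_pos: "0 < l"
  using l norm_ge_zero[of "p o\<^sub>L a o\<^sub>L p"] unfolding compression_norm_def by linarith

text \<open>Comparison with a geometric series of ratio \<open>N / l < 1\<close>. Absolute
  convergence serves the Cauchy products below.\<close>

lemma summable_norm_res:
  assumes h: "h \<in> A"
  shows "summable (\<lambda>n. norm (res_coeff l h n))"
proof (rule summable_norm_comparison_test)
  have N0: "0 \<le> N" by (simp add: compression_norm_def)
  show "summable (\<lambda>n. (norm p * norm h / l) * (N / l) ^ n)"
    using l l_pos N0 by (intro summable_mult summable_geometric) auto
  have "norm (res_coeff l h n) \<le> (norm p * norm h / l) * (N / l) ^ n" for n
  proof -
    have "cmod (\<tau> (comp_pow n o\<^sub>L h)) \<le> norm (comp_pow n o\<^sub>L h)"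
      using h by (intro cmod_tau_le_norm) auto
    also have "\<dots> \<le> norm (comp_pow n) * norm h"
      by (rule norm_blinfun_compose)
    also have "\<dots> \<le> N ^ n * norm p * norm h"
      by (intro mult_right_mono norm_comp_pow) simp
    finally show ?thesis
      using l_pos by (simp add: res_coeff_def norm_divide norm_power norm_mult field_simps)
  qed
  then show "\<exists>M. \<forall>n\<ge>M. norm (res_coeff l h n) \<le> (norm p * norm h / l) * (N / l) ^ n"
    by blast
qed

lemma summable_res: "h \<in> A \<Longrightarrow> summable (res_coeff l h)"
  using summable_norm_res by (rule summable_norm_cancel)

lemma res_add:
  assumes "h \<in> A" "k \<in> A"
  shows "res l (h + k) = res l h + res l k"
proof -
  have "res_coeff l (h + k) n = res_coeff l h n + res_coeff l k n" for n
  proof -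
    have "comp_pow n o\<^sub>L (h + k) = (comp_pow n o\<^sub>L h) + (comp_pow n o\<^sub>L k)"
      by (rule blinfun_eqI) (simp add: blinfun.add_left blinfun.add_right)
    then show ?thesis
      using assms by (simp add: res_coeff_def tau_simps A_intros comp_pow_in_A add_divide_distrib)
  qed
  then have "res_coeff l (h + k) = (\<lambda>n. res_coeff l h n + res_coeff l k n)" ..
  then show ?thesis
    unfolding res_def using assms by (simp add: suminf_add[symmetric] summable_res)
qed

lemma res_scaleR:
  assumes "h \<in> A"
  shows "res l (r *\<^sub>R h) = of_real r * res l h"
proof -
  have "res_coeff l (r *\<^sub>R h) n = of_real r * res_coeff l h n" for n
  proof -
    have "comp_pow n o\<^sub>L (r *\<^sub>R h) = r *\<^sub>R (comp_pow n o\<^sub>L h)"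
      by (rule blinfun_eqI) (simp add: blinfun.scaleR_left blinfun.scaleR_right)
    then show ?thesis
      using assms by (simp add: res_coeff_def tau_simps A_intros comp_pow_in_A)
  qed
  then have "res_coeff l (r *\<^sub>R h) = (\<lambda>n. of_real r * res_coeff l h n)" ..
  then show ?thesis
    unfolding res_def using assms by (simp add: suminf_mult summable_res)
qed

lemma res_diff:
  assumes "h \<in> A" "k \<in> A"
  shows "res l (h - k) = res l h - res l k"
  using res_add[of h "(-1) *\<^sub>R k"] res_scaleR[of k "-1"] assms A_intros(5)[of k "-1"] by simp

text \<open>By traciality each coefficient is a positive multiple of the trace of
  \<open>comp_pow n\<close> conjugated by \<open>b\<close>. So the series has nonnegative real terms
  and dominates its term of index 0.\<close>

lemma res_square:
  assumes b: "b \<in> A" "is_adjoint b b"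
  shows "Im (res l (b o\<^sub>L b)) = 0" "Re (res l (b o\<^sub>L b)) \<ge> Re (\<tau> (p o\<^sub>L (b o\<^sub>L b))) / l"
proof -
  have "\<tau> (comp_pow n o\<^sub>L (b o\<^sub>L b)) \<in> \<real>\<^sub>\<ge>\<^sub>0" for n
  proof -
    have "\<tau> (b o\<^sub>L comp_pow n o\<^sub>L b) \<in> \<real>\<^sub>\<ge>\<^sub>0"
      using b by (intro tau_positive positive_op_conj positive_comp_pow) auto
    also have "\<tau> (b o\<^sub>L comp_pow n o\<^sub>L b) = \<tau> (comp_pow n o\<^sub>L (b o\<^sub>L b))"
      using tau_commute[of b "comp_pow n o\<^sub>L b"] b by (auto simp: blinfun_compose_assoc)
    finally show ?thesis .
  qed
  then have "Re (\<tau> (comp_pow n o\<^sub>L (b o\<^sub>L b))) \<ge> 0" "Im (\<tau> (comp_pow n o\<^sub>L (b o\<^sub>L b))) = 0" for n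
    by (auto simp: complex_nonneg_Reals_iff)
  then have coeff: "Re (res_coeff l (b o\<^sub>L b) n) \<ge> 0" "Im (res_coeff l (b o\<^sub>L b) n) = 0" for n
    using l_pos by (simp_all add: res_coeff_def Re_divide_of_real Im_divide_of_real flip: of_real_power of_real_mult)
  have "res_coeff l (b o\<^sub>L b) sums res l (b o\<^sub>L b)"
    unfolding res_def using b by (intro summable_sums summable_res) auto
  then have sums: "(\<lambda>n. Re (res_coeff l (b o\<^sub>L b) n)) sums Re (res l (b o\<^sub>L b))"
    "(\<lambda>n. Im (res_coeff l (b o\<^sub>L b) n)) sums Im (res l (b o\<^sub>L b))"
    by (simp_all add: sums_complex_iff)
  show "Im (res l (b o\<^sub>L b)) = 0"
    using sums(2) coeff(2) by (simp add: sums_unique2[OF _ sums_zero])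
  have "(\<Sum>n<1. Re (res_coeff l (b o\<^sub>L b) n)) \<le> Re (res l (b o\<^sub>L b))"
    using coeff(1) sums(1) by (metis sums_iff sum_le_suminf finite_lessThan)
  then show "Re (res l (b o\<^sub>L b)) \<ge> Re (\<tau> (p o\<^sub>L (b o\<^sub>L b))) / l"
    by (simp add: res_coeff_def Re_divide_of_real)
qed

text \<open>This is \<open>(p a p) R = l R - p\<close> under the trace. In the series it is a shift
  of index, and the lost term of index 0 produces \<open>t\<close>.\<close>

lemma res_a: "res l a = of_real l * res l id_blinfun - of_real t"
proof -
  have "\<tau> (comp_pow n o\<^sub>L a) = \<tau> (comp_pow (Suc n))" for n
    using tau_commute[of p "comp_pow n o\<^sub>L a"] pA aA
    by (simp add: A_intros comp_pow_in_A p_comp_pow flip: blinfun_compose_assoc)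
  then have eq: "res_coeff l a = (\<lambda>n. of_real l * res_coeff l id_blinfun (Suc n))"
    using l_pos by (auto simp: res_coeff_def simp del: comp_pow.simps)
  have "(\<Sum>n. res_coeff l id_blinfun (Suc n)) = res l id_blinfun - res_coeff l id_blinfun 0"
    unfolding res_def by (rule suminf_split_head[OF summable_res]) (rule A_intros)
  moreover have "(\<Sum>n. of_real l * res_coeff l id_blinfun (Suc n)) = of_real l * (\<Sum>n. res_coeff l id_blinfun (Suc n))"
    by (rule suminf_mult) (simp add: summable_Suc_iff summable_res A_intros)
  moreover have "res_coeff l id_blinfun 0 = of_real t / of_real l"
    by (simp add: res_coeff_def tau_p)
  ultimately have "res l a = of_real l * (res l id_blinfun - of_real t / of_real l)"
    unfolding res_def[of l a] eq by simp
  then show ?thesis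
    using l_pos by (simp add: right_diff_distrib)
qed

text \<open>The generating function in \<open>1 / l\<close> of the identities
  \<open>comp_pow_derivation_identity\<close>; their convolutions become Cauchy products.\<close>

lemma res_derivation_identity:
  assumes h: "h \<in> alg_a"
  shows "res l a * res l h - res l id_blinfun * res l (h o\<^sub>L a) + res l h - res l id_blinfun * \<tau> h = 0"
proof -
  have A: "h \<in> A" "h o\<^sub>L a \<in> A" "id_blinfun \<in> A" using h aA by auto
  let ?f = "res_coeff l"
  \<comment> \<open>The identity at 0 has an empty sum and is kept apart: the one at
    \<open>Suc n\<close> is what matches the Cauchy coefficient of index \<open>n\<close>.\<close>
  have zero: "?f h 0 = ?f id_blinfun 0 * \<tau> h"
    using comp_pow_derivation_identity[OF h, of 0] by (simp add: res_coeff_def)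
  have coeff: "(\<Sum>j\<le>n. ?f a j * ?f h (n - j)) - (\<Sum>j\<le>n. ?f id_blinfun j * ?f (h o\<^sub>L a) (n - j))
      + ?f h (Suc n) - ?f id_blinfun (Suc n) * \<tau> h = 0" for n
  proof -
    have prod: "(\<Sum>j\<le>n. ?f x j * ?f y (n - j)) =
        (\<Sum>j\<le>n. \<tau> (comp_pow j o\<^sub>L x) * \<tau> (comp_pow (n - j) o\<^sub>L y)) / of_real l ^ Suc (Suc n)" for x y
      unfolding sum_divide_distrib
    proof (rule sum.cong)
      fix j assume "j \<in> {..n}"
      then have "of_real l ^ Suc j * of_real l ^ Suc (n - j) = (of_real l ^ Suc (Suc n) :: complex)"
        unfolding power_add[symmetric] by simp
      then show "?f x j * ?f y (n - j) =
          \<tau> (comp_pow j o\<^sub>L x) * \<tau> (comp_pow (n - j) o\<^sub>L y) / of_real l ^ Suc (Suc n)"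
        by (simp add: res_coeff_def del: power_Suc)
    qed simp
    have "(\<Sum>j\<le>n. ?f a j * ?f h (n - j)) - (\<Sum>j\<le>n. ?f id_blinfun j * ?f (h o\<^sub>L a) (n - j))
      + ?f h (Suc n) - ?f id_blinfun (Suc n) * \<tau> h =
      ((\<Sum>j<Suc n. \<tau> (comp_pow j o\<^sub>L a) * \<tau> (comp_pow (Suc n - Suc j) o\<^sub>L h)
        - \<tau> (comp_pow j) * \<tau> (comp_pow (Suc n - Suc j) o\<^sub>L (h o\<^sub>L a)))
    + \<tau> (comp_pow (Suc n) o\<^sub>L h) - \<tau> (comp_pow (Suc n)) * \<tau> h) / of_real l ^ Suc (Suc n)"
      unfolding prod by (simp add: lessThan_Suc_atMost sum_subtractf
          diff_divide_distrib add_divide_distrib res_coeff_def del: power_Suc comp_pow.simps sum.lessThan_Suc)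
    then show ?thesis
      unfolding comp_pow_derivation_identity[OF h] by simp
  qed
  have tail: "(\<lambda>n. ?f x (Suc n)) sums (res l x - ?f x 0)" if "x \<in> A" for x
    using summable_res[OF that] unfolding res_def sums_Suc_iff by (simp add: summable_sums)
  have "(\<lambda>n. (\<Sum>j\<le>n. ?f a j * ?f h (n - j)) - (\<Sum>j\<le>n. ?f id_blinfun j * ?f (h o\<^sub>L a) (n - j))
      + ?f h (Suc n) - ?f id_blinfun (Suc n) * \<tau> h) sums
      (res l a * res l h - res l id_blinfun * res l (h o\<^sub>L a) + (res l h - ?f h 0) - (res l id_blinfun - ?f id_blinfun 0) * \<tau> h)"
    using A aA unfolding res_def
    by (intro sums_add sums_diff sums_mult2 Cauchy_product_sums summable_norm_res tail[unfolded res_def])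
  then have "res l a * res l h - res l id_blinfun * res l (h o\<^sub>L a) + (res l h - ?f h 0) - (res l id_blinfun - ?f id_blinfun 0) * \<tau> h = 0"
    unfolding coeff using sums_unique2 sums_zero by blast
  then show ?thesis
    by (simp add: zero algebra_simps)
qed

section \<open>The lower bound from subordination and positivity\<close>

lemma compression_bound_le_of_norm_less:
  assumes t: "0 < t" "t \<le> 1"
  shows "(1 - t) * Re (\<tau> a) + 2 * std_dev \<tau> a * sqrt (t * (1 - t)) \<le> l"
proof -
  define w where "w = Re (res l id_blinfun)"
  \<comment> \<open>\<open>res_square\<close> at \<open>b = id_blinfun\<close> shows that the value
    is real and at least \<open>t / l\<close>, which makes division by \<open>w\<close>
    legitimate.\<close>
  have res_id: "res l id_blinfun = of_real w" and "w \<ge> t / l"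
    using res_square[OF A_intros(1) is_adjoint_id] by (simp_all add: w_def complex_eq_iff tau_p)
  then have w: "w > 0"
    using t l_pos by (meson divide_pos_pos less_le_trans)
  \<comment> \<open>After inserting \<open>res_a\<close>, the derivation identity has the
    coefficient \<open>l * w - t + 1\<close> at \<open>res l k\<close>, and this equals
    \<open>w * x\<close>.\<close>
  define x where "x = l + (1 - t) / w"
  have x: "x > 0"
    using l_pos w t by (simp add: x_def add_pos_nonneg)
  define m where "m = Re (\<tau> a)"
  have tau_a: "\<tau> a = of_real m"
    using tau_a_real by (simp add: m_def)
  define y where "y = 1 / x"
  have xy: "x * y = 1" using x by (simp add: y_def)
  define v where "v = a - m *\<^sub>R id_blinfun"
  define e where "e = x *\<^sub>R id_blinfun - a"
  \<comment> \<open>For a trial element \<open>1 + c v\<close>, positivity of \<open>a\<close>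
    bounds the trace of \<open>h e h\<close> by \<open>x - m + (c\<^sup>2 * x - 2 * c) * S2\<close>;
    the choice \<open>c = 1 / x\<close> minimises this.\<close>
  define h where "h = id_blinfun + y *\<^sub>R v"
  \<comment> \<open>\<open>w h\<close> plays the role of an approximate inverse of \<open>e\<close>,
    and \<open>b\<close> is its defect.\<close>
  define b where "b = id_blinfun - w *\<^sub>R (h o\<^sub>L e)"
  note alg_intros = subalgebra_intros[OF unital_subalgebra_generated]
  have alg: "a \<in> alg_a" "v \<in> alg_a" "e \<in> alg_a" "h \<in> alg_a" "b \<in> alg_a"
    unfolding b_def h_def e_def v_def by (intro alg_intros a_alg_a)+
  note in_A = alg[THEN alg_a_A]
  have res_e: "res l (k o\<^sub>L e) = \<tau> k" if k: "k \<in> alg_a" for k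
  proof -
    have "k o\<^sub>L e = x *\<^sub>R k - (k o\<^sub>L a)"
      by (rule blinfun_eqI) (simp add: e_def blinfun.bilinear_simps)
    then have "res l (k o\<^sub>L e) = of_real x * res l k - res l (k o\<^sub>L a)"
      using k aA by (simp add: alg_a_A A_intros res_diff res_scaleR)
    moreover have "of_real w * (of_real x * res l k - res l (k o\<^sub>L a)) = of_real w * \<tau> k"
      using res_derivation_identity[OF k] w unfolding res_a res_id 
      by (simp add: x_def field_simps)
    ultimately show ?thesis
      using w by simp
  qed
  have sa: "is_adjoint v v" "is_adjoint e e" "is_adjoint h h"
    unfolding h_def e_def v_def
    by (intro is_adjoint_diff is_adjoint_add is_adjoint_scaleR is_adjoint_id a_adjoint)+
  have comm: "h o\<^sub>L e = e o\<^sub>L h"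
    by (rule blinfun_eqI) (simp add: h_def e_def v_def blinfun.bilinear_simps algebra_simps)
  have "is_adjoint b b"
    using is_adjoint_compose[OF sa(3,2)] unfolding b_def
    by (intro is_adjoint_diff is_adjoint_scaleR is_adjoint_id) (simp add: comm)
  with in_A have "Re (res l (b o\<^sub>L b)) \<ge> Re (\<tau> (p o\<^sub>L (b o\<^sub>L b))) / l"
    by (intro res_square)
  moreover have "Re (\<tau> (p o\<^sub>L (b o\<^sub>L b))) \<ge> 0"
  proof -
    have "\<tau> (b o\<^sub>L p o\<^sub>L b) \<in> \<real>\<^sub>\<ge>\<^sub>0"
      using in_A pA positive_comp_pow[of 0] \<open>is_adjoint b b\<close> by (intro tau_positive positive_op_conj) auto
    also have "\<tau> (b o\<^sub>L p o\<^sub>L b) = \<tau> (p o\<^sub>L (b o\<^sub>L b))"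
      using tau_commute[of b "p o\<^sub>L b"] in_A pA by (auto simp: blinfun_compose_assoc)
    finally show ?thesis by (simp add: complex_nonneg_Reals_iff)
  qed
  ultimately have res_bb: "0 \<le> Re (res l (b o\<^sub>L b))"
    using l_pos by (meson divide_nonneg_pos order_trans)
  have tau_v: "\<tau> v = 0"
    using aA by (simp add: v_def tau_simps A_intros tau_a)
  have tau_h: "\<tau> h = 1"
    using in_A by (simp add: h_def tau_simps A_intros tau_v)
  \<comment> \<open>Every term but the first ends in the factor \<open>e\<close>, the form that
    \<open>res_e\<close> evaluates.\<close>
  have bb: "b o\<^sub>L b = id_blinfun - (2 * w) *\<^sub>R (h o\<^sub>L e) + w\<^sup>2 *\<^sub>R ((h o\<^sub>L e o\<^sub>L h) o\<^sub>L e)"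
  proof -
    have "(h o\<^sub>L e) o\<^sub>L (h o\<^sub>L e) = (h o\<^sub>L e o\<^sub>L h) o\<^sub>L e"
      by (simp add: blinfun_compose_assoc)
    moreover have "b o\<^sub>L b = id_blinfun - (2 * w) *\<^sub>R (h o\<^sub>L e) + w\<^sup>2 *\<^sub>R ((h o\<^sub>L e) o\<^sub>L (h o\<^sub>L e))"
      by (rule blinfun_eqI)
         (simp add: b_def blinfun.bilinear_simps algebra_simps power2_eq_square flip: scaleR_2)
    ultimately show ?thesis by simp
  qed
  have heh: "h o\<^sub>L e o\<^sub>L h = (x - m) *\<^sub>R id_blinfun + (2 * y * (x - m) - 1) *\<^sub>R v
      + (y\<^sup>2 * (x - m) - 2 * y) *\<^sub>R (v o\<^sub>L v) - y\<^sup>2 *\<^sub>R (v o\<^sub>L v o\<^sub>L v)"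
  proof -
    have e_v: "e = (x - m) *\<^sub>R id_blinfun - v"
      by (simp add: e_def v_def algebra_simps)
    show ?thesis
      unfolding e_v
      by (intro blinfun_eqI)
         (simp add: h_def blinfun.bilinear_simps algebra_simps power2_eq_square flip: scaleR_2)
  qed
  define S2 where "S2 = Re (\<tau> (v o\<^sub>L v))"
  define S3 where "S3 = Re (\<tau> (v o\<^sub>L v o\<^sub>L v))"
  have res_bb_eq: "Re (res l (b o\<^sub>L b)) = w - 2 * w + w\<^sup>2 * Re (\<tau> (h o\<^sub>L e o\<^sub>L h))"
    unfolding bb using in_A alg
    by (simp add: res_add res_diff res_scaleR A_intros res_id res_e alg_intros tau_h flip: of_real_power)
  have heh_tau: "Re (\<tau> (h o\<^sub>L e o\<^sub>L h)) = (x - m) + (y\<^sup>2 * (x - m) - 2 * y) * S2 - y\<^sup>2 * S3"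
    unfolding heh using in_A by (simp add: tau_simps A_intros tau_v S2_def S3_def)
  \<comment> \<open>Positivity of \<open>a\<close>, conjugated by \<open>v\<close>, bounds the third
    central moment from below.\<close>
  have "S3 + m * S2 \<ge> 0"
  proof -
    have "\<tau> (v o\<^sub>L a o\<^sub>L v) \<in> \<real>\<^sub>\<ge>\<^sub>0"
      using in_A sa by (intro tau_positive positive_op_conj pos) auto
    moreover have "v o\<^sub>L a o\<^sub>L v = (v o\<^sub>L v o\<^sub>L v) + m *\<^sub>R (v o\<^sub>L v)"
      by (rule blinfun_eqI) (simp add: v_def blinfun.bilinear_simps algebra_simps)
    ultimately show ?thesis
      using in_A by (simp add: tau_simps A_intros S2_def S3_def complex_nonneg_Reals_iff)
  qed
  then have "0 \<le> y\<^sup>2 * (S3 + m * S2)"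
    by simp
  moreover have "y\<^sup>2 * (x - m) * S2 - y\<^sup>2 * S3 = (x * y) * y * S2 - y\<^sup>2 * (S3 + m * S2)"
    by (simp add: algebra_simps power2_eq_square)
  ultimately have "Re (\<tau> (h o\<^sub>L e o\<^sub>L h)) \<le> x - m - y * S2"
    unfolding heh_tau xy by (simp add: left_diff_distrib)
  then have "w\<^sup>2 * Re (\<tau> (h o\<^sub>L e o\<^sub>L h)) \<le> w\<^sup>2 * (x - m - y * S2)"
    by (rule mult_left_mono) simp
  then have "0 \<le> w - 2 * w + w\<^sup>2 * (x - m - y * S2)"
    using res_bb unfolding res_bb_eq by linarith
  then have "0 \<le> w * (w * (x - m - y * S2) - 1)"
    by (simp add: algebra_simps power2_eq_square)
  then have "1 \<le> (x - m - y * S2) * w"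
    using w by (simp only: zero_le_mult_iff) (simp add: mult.commute)
  then have "1 / w \<le> x - m - y * S2"
    using w by (simp only: pos_divide_le_eq)
  then have "(1 - t) * (1 / w) \<le> (1 - t) * (x - m - y * S2)"
    using t by (intro mult_left_mono) auto
  then have "x - l \<le> (1 - t) * (x - m - y * S2)"
    by (simp add: x_def)
  then have l_ge: "t * x + (1 - t) * y * S2 + (1 - t) * m \<le> l"
    by (simp add: algebra_simps)
  define s where "s = std_dev \<tau> a"
  have S2: "S2 = s\<^sup>2"
    by (simp add: S2_def s_def v_def m_def tau_centred_square)
  \<comment> \<open>Arithmetic-geometric mean inequality for \<open>t * x\<close> and
    \<open>(1 - t) * y * s\<^sup>2\<close>; their product is independent of \<open>x\<close> because
    \<open>x * y = 1\<close>.\<close>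
  have "0 \<le> (sqrt t * x - s * sqrt (1 - t))\<^sup>2 * y"
    using x by (simp add: y_def)
  also have "\<dots> = t * x * (x * y) + (1 - t) * y * s\<^sup>2 - 2 * s * sqrt (t * (1 - t)) * (x * y)"
    unfolding real_sqrt_mult
    using t by (simp add: power2_diff power_mult_distrib power2_eq_square[of x] algebra_simps)
  finally show ?thesis
    using l_ge by (simp add: xy S2 m_def s_def)
qed

end

text \<open>The Neumann series needs \<open>l\<close> strictly above \<open>N\<close>; the bound is
  independent of \<open>l\<close>, so it passes to the limit.\<close>

theorem compression_norm_bound:
  assumes "0 < t" "t \<le> 1"
  shows "(1 - t) * Re (\<tau> a) + 2 * std_dev \<tau> a * sqrt (t * (1 - t)) \<le> N"
  by (rule dense_ge) (rule compression_bound_le_of_norm_less[OF _ assms])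

end

section \<open>Comparison with the form of the estimate that involves \<open>eps\<close>\<close>

lemma eps_le_1:
  assumes "0 \<le> L" "0 \<le> std_dev \<tau> a" "1 \<le> s"
  shows "eps \<tau> L a s \<le> 1"
proof -
  define z where "z = std_dev \<tau> a * sqrt (s - 1)"
  have "0 \<le> z"
    using assms by (simp add: z_def)
  then have "L + z = 0 \<or> 0 < L + z"
    using assms(1) by linarith
  then show ?thesis
    using assms(1) unfolding eps_def z_def[symmetric] by auto
qed

theorem theorem2p13:
  fixes A :: "'h::complex_hilbert op set"
    and \<tau> :: "'h op \<Rightarrow> complex"
    and a p :: "'h op"
    and L t :: real
  assumes "II1_factor A"
    and "faithful_normal_tracial_state A \<tau>"
    and "a \<in> A" and "positive_op a" and "norm a \<le> L"
    and "0 < t" and "t \<le> 1"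
    and "p \<in> A" and "projection_op p" and "\<tau> p = complex_of_real t"
    and "free_from \<tau> p a"
  shows "compression_norm p a \<ge>
    Re (\<tau> a) + (1 + eps \<tau> L a (1 / t)) * std_dev \<tau> a * sqrt (t * (1 - t)) - t * (L + Re (\<tau> a))"
proof -
  interpret free_compression A \<tau> p a t
    using assms by unfold_locales
      (auto simp: II1_factor_def factor_def von_neumann_algebra_def faithful_normal_tracial_state_def)
  have L: "0 \<le> L"
    using assms(5) norm_ge_zero order_trans by blast
  have sd: "0 \<le> std_dev \<tau> a"
    by (rule tau_centred_square(2))
  \<comment> \<open>\<open>1 + eps\<close> is at most 2, the factor in
    \<open>compression_norm_bound\<close>; the remaining difference between the two bounds is
    \<open>t * L\<close>.\<close>
  have "(1 + eps \<tau> L a (1 / t)) * (std_dev \<tau> a * sqrt (t * (1 - t))) \<le> 2 * (std_dev \<tau> a * sqrt (t * (1 - t)))"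
    using eps_le_1[OF L sd, of "1 / t"] sd assms(6,7)
    by (intro mult_right_mono) auto
  moreover have "0 \<le> t * L"
    using assms(6) L by simp
  ultimately show ?thesis
    using compression_norm_bound[OF assms(6,7)] by (simp add: algebra_simps)
qed

end
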